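(* For any $\alpha > 0$, there is an $M_0$ satisfying $$\log\log M_0 \le \alpha n + O(\log n)$$ such that with probability $1-\exp(-n)$, a random family $\mathcal{F}$ (of functions $\{0,1\}^n\to\{0,1\}^n$) with designed size $M \ge M_0$ satisfies the following: there is no coding scheme (of block length $n$) achieving rate at least $1-\alpha$ and error $\epsilon < 1$ that is non-malleable with respect to the tampering family $\mathcal{F}$.
   Context: Logarithms are to base $2$. A random family $\mathcal{F}$ with designed size $M$ is obtained as follows: for each $i\in\{1,\dots,M\}$, sample a uniformly random function $f_i\colon\{0,1\}^n\to\{0,1\}^n$ (independently) and add $f_i$ to the family (coincidences are allowed, so $|\mathcal{F}|\le M$). Coding scheme. A coding scheme with block length $n$ and message length $k\le n$ is a pair $\mathsf{Enc}\colon \{0,1\}^k \to \{0,1\}^n$, $\mathsf{Dec}\colon \{0,1\}^n \to \{0,1\}^k \cup \{\perp\}$, where $\mathsf{Enc}$ is randomized (using uniform internal coin flips), $\mathsf{Dec}$ is deterministic, and $\mathsf{Dec}(\mathsf{Enc}(s)) = s$ with probability $1$ for every $s\in\{0,1\}^k$. Its rate is $k/n$. Non-malleability. For a special symbol $\mathsf{same}$, let $\mathrm{copy}(x,y) := x$ if $x\ne\mathsf{same}$ and $\mathrm{copy}(\mathsf{same},y) := y$. A coding scheme is non-malleable with error $\epsilon$ with respect to a family $\mathcal{F}$ of functions $\{0,1\}^n\to\{0,1\}^n$ if for every $f\in\mathcal{F}$ there is a distribution $\mathcal{D}_f$ over $\{0,1\}^k\cup\{\perp,\mathsf{same}\}$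 such that for every $s\in\{0,1\}^k$, the distribution of $\mathsf{Dec}(f(\mathsf{Enc}(s)))$ is within statistical (total variation) distance $\epsilon$ of the distribution of $\mathrm{copy}(S',s)$, where $S'\sim\mathcal{D}_f$.
   Formalization: Restricted to α < 1, since for α ≥ 1 the rate condition is void and the claim fails (k = 0 has error 0); ε < 1 is a fixed constant and n is large depending on α and ε, since a uniform D_f always gives error at most 1 − 1/(2^k+2) < 1. *)

theory Defs
  imports "HOL-Probability.Probability" "HOL-Library.Landau_Symbols"
begin

definition bits :: "nat \<Rightarrow> bool list set" where
  "bits n = {x. length x = n}"

text \<open>The values \<open>f\<^sub>i\<close> are independent uniform functions from \<^term>\<open>bits n\<close> to itself
  (with value \<^const>\<open>undefined\<close> outside \<^term>\<open>bits n\<close>), so the family is a random set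
  of at most \<open>M\<close> functions.\<close>

definition random_family :: "nat \<Rightarrow> nat \<Rightarrow> (bool list \<Rightarrow> bool list) set pmf" where
  "random_family n M =
     map_pmf (\<lambda>fs. fs ` {1..M})
       (Pi_pmf {1..M} undefined (\<lambda>i. pmf_of_set (bits n \<rightarrow>\<^sub>E bits n)))"

definition coin_flips :: "bool stream measure" where
  "coin_flips = stream_space (measure_pmf (bernoulli_pmf (1/2)))"

text \<open>A randomized encoder is represented by the distribution \<^term>\<open>Enc s\<close> of the codeword of
  each message \<open>s\<close>; it has to be the law of a function of internal fair coin flips.
  The supply of coins is infinite so that no bound on the number of flips
  is imposed. The decoder outputs \<^const>\<open>None\<close> for the symbol \<open>\<bottom>\<close>.\<close>

definition coding_scheme ::
  "nat \<Rightarrow> nat \<Rightarrow> (bool list \<Rightarrow> bool list pmf) \<Rightarrow> (bool list \<Rightarrow> bool list option) \<Rightarrow> bool" where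
  "coding_scheme n k Enc Dec \<longleftrightarrow>
     k \<le> n \<and>
     (\<forall>s\<in>bits k. set_pmf (Enc s) \<subseteq> bits n) \<and>
     (\<forall>s\<in>bits k. \<exists>enc \<in> coin_flips \<rightarrow>\<^sub>M count_space UNIV.
        measure_pmf (Enc s) = distr coin_flips (count_space UNIV) enc) \<and>
     (\<forall>c\<in>bits n. Dec c \<in> insert None (Some ` bits k)) \<and>
     (\<forall>s\<in>bits k. measure_pmf.prob (Enc s) {c. Dec c = Some s} = 1)"

definition rate :: "nat \<Rightarrow> nat \<Rightarrow> real" where
  "rate n k = real k / real n"

definition tv_dist :: "'a pmf \<Rightarrow> 'a pmf \<Rightarrow> real" where
  "tv_dist p q = (SUP A. \<bar>measure_pmf.prob p A - measure_pmf.prob q A\<bar>)"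

datatype sim_output = Same | Output "bool list option"

fun copy :: "sim_output \<Rightarrow> bool list \<Rightarrow> bool list option" where
  "copy Same s = Some s"
| "copy (Output y) s = y"

definition non_malleable ::
  "nat \<Rightarrow> (bool list \<Rightarrow> bool list pmf) \<Rightarrow> (bool list \<Rightarrow> bool list option) \<Rightarrow> real \<Rightarrow>
   (bool list \<Rightarrow> bool list) set \<Rightarrow> bool" where
  "non_malleable k Enc Dec \<epsilon> F \<longleftrightarrow>
     (\<forall>f\<in>F. \<exists>D :: sim_output pmf.
        set_pmf D \<subseteq> {Same, Output None} \<union> (Output \<circ> Some) ` bits k \<and>
        (\<forall>s\<in>bits k.
           tv_dist (map_pmf (\<lambda>c. Dec (f c)) (Enc s)) (map_pmf (\<lambda>x. copy x s) D) \<le> \<epsilon>))"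

end

theory Submission
  imports Defs "HOL-Real_Asymp.Real_Asymp"
begin

text \<open>Encodings of different messages have disjoint supports, so at rate \<open>1 - \<alpha>\<close> half of the messages
  have at most \<open>2 * 2 powr (\<alpha> n)\<close> codewords each. Together, \<open>n\<close> such messages occupy only
  \<open>N = O(n * 2 powr (\<alpha> n))\<close> points. A family of \<open>2 ^ (4 n N)\<close> random functions realizes every
  partial function on at most \<open>N\<close> points: there are at most \<open>2 ^ (2 n N)\<close> of these, and each is
  extended by a random function with probability at least \<open>2 ^ (- n N)\<close>. So some \<open>f\<close> in the family
  maps the codewords of each of these messages to a codeword of a different message. Using \<open>n\<close>
  messages, rather than a number depending on \<open>\<epsilon>\<close>, defeats every fixed \<open>\<epsilon> < 1\<close> for large \<open>n\<close>.\<close>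

lemma finite_bits [simp]: "finite (bits n)"
  and card_bits [simp]: "card (bits n) = 2 ^ n"
  using finite_lists_length_eq[of "UNIV :: bool set" n] card_lists_length_eq[of "UNIV :: bool set" n]
  by (simp_all add: bits_def)

lemma bits_nonempty [simp]: "bits n \<noteq> {}"
  using card_bits[of n] by (metis card.empty power_eq_0_iff zero_neq_numeral)

section \<open>Random families and interpolation on small sets\<close>

definition interpolating :: "nat \<Rightarrow> nat \<Rightarrow> (bool list \<Rightarrow> bool list) set \<Rightarrow> bool" where
  "interpolating n N F \<longleftrightarrow>
     (\<forall>T\<subseteq>bits n. \<forall>g\<in>T \<rightarrow> bits n. T \<noteq> {} \<longrightarrow> card T \<le> N \<longrightarrow> (\<exists>f\<in>F. \<forall>x\<in>T. f x = g x))"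

text \<open>Agreement with \<open>g\<close> on \<open>T\<close> cuts the function space down to a
  product whose factors over \<open>T\<close> are singletons, so each point of \<open>T\<close>
  costs a factor \<open>2 ^ n\<close>.\<close>

lemma prob_uniform_function_agrees:
  assumes "T \<subseteq> bits n" and "g \<in> T \<rightarrow> bits n"
  shows "measure_pmf.prob (pmf_of_set (bits n \<rightarrow>\<^sub>E bits n)) {f. \<forall>x\<in>T. f x = g x} = 1 / 2 ^ (n * card T)"
proof -
  let ?A = "bits n \<rightarrow>\<^sub>E bits n"
  have fin: "finite ?A" by (simp add: finite_PiE)
  have ne: "?A \<noteq> {}" by (simp add: PiE_eq_empty_iff)
  have finT: "finite T" using assms(1) by (rule finite_subset) simp
  have "?A \<inter> {f. \<forall>x\<in>T. f x = g x} = (\<Pi>\<^sub>E x\<in>bits n. if x \<in> T then {g x} else bits n)"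
  proof (intro equalityI subsetI)
    fix f assume "f \<in> ?A \<inter> {f. \<forall>x\<in>T. f x = g x}"
    thus "f \<in> (\<Pi>\<^sub>E x\<in>bits n. if x \<in> T then {g x} else bits n)" by (simp add: PiE_iff)
  next
    fix f assume "f \<in> (\<Pi>\<^sub>E x\<in>bits n. if x \<in> T then {g x} else bits n)"
    hence ext: "f \<in> extensional (bits n)"
      and f: "\<forall>x\<in>bits n. f x \<in> (if x \<in> T then {g x} else bits n)"
      unfolding PiE_iff by blast+
    have agree: "f x = g x" if "x \<in> T" for x
      using bspec[OF f, of x] that assms(1) by auto
    have "f x \<in> bits n" if "x \<in> bits n" for x
      using bspec[OF f that] agree[of x] assms(2) by (cases "x \<in> T") auto
    thus "f \<in> ?A \<inter> {f. \<forall>x\<in>T. f x = g x}" using ext agree by (simp add: PiE_iff)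
  qed
  hence "card (?A \<inter> {f. \<forall>x\<in>T. f x = g x}) = (\<Prod>x\<in>bits n. if x \<in> T then 1 else 2 ^ n)"
    by (simp add: card_PiE if_distrib cong: if_cong)
  also have "\<dots> = (2 ^ n) ^ card (bits n - T)"
    by (simp add: prod.If_cases Diff_eq)
  also have "card (bits n - T) = 2 ^ n - card T"
    using assms(1) finT by (simp add: card_Diff_subset)
  finally have num: "card (?A \<inter> {f. \<forall>x\<in>T. f x = g x}) = 2 ^ (n * (2 ^ n - card T))"
    by (simp add: power_mult)
  have "card T \<le> 2 ^ n" using card_mono[OF _ assms(1)] by simp
  hence "n * 2 ^ n = n * (2 ^ n - card T) + n * card T"
    by (simp flip: distrib_left)
  hence "(2::real) ^ (n * 2 ^ n) = 2 ^ (n * (2 ^ n - card T)) * 2 ^ (n * card T)"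
    by (simp flip: power_add)
  moreover have "card ?A = 2 ^ (n * 2 ^ n)"
    by (simp add: card_PiE power_mult)
  ultimately show ?thesis
    using num by (simp add: measure_pmf_of_set[OF ne fin])
qed

text \<open>By independence all samples miss with probability \<open>(1 - p) ^ M\<close>, which is
  at most \<open>exp (- (M * p))\<close>; here \<open>p\<close> is at least
  \<open>1 / 2 ^ (n * N)\<close>.\<close>

lemma prob_random_family_misses:
  assumes "T \<subseteq> bits n" and "g \<in> T \<rightarrow> bits n" and "card T \<le> N"
  shows "measure_pmf.prob (random_family n M) {F. \<not> (\<exists>f\<in>F. \<forall>x\<in>T. f x = g x)}
           \<le> exp (- (real M / 2 ^ (n * N)))"
proof -
  let ?U = "pmf_of_set (bits n \<rightarrow>\<^sub>E bits n)"
  let ?A = "{f. \<forall>x\<in>T. f x = g x}"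
  let ?p = "measure_pmf.prob ?U ?A"
  have "measure_pmf.prob (random_family n M) {F. \<not> (\<exists>f\<in>F. \<forall>x\<in>T. f x = g x)}
      = measure_pmf.prob (Pi_pmf {1..M} undefined (\<lambda>i. ?U)) (Pi {1..M} (\<lambda>_. - ?A))"
    unfolding random_family_def measure_map_pmf by (rule arg_cong[where f = "measure _"]) auto
  also have "\<dots> = (1 - ?p) ^ M"
    using measure_pmf.prob_compl[of ?A ?U] by (simp add: measure_Pi_pmf_Pi Compl_eq_Diff_UNIV)
  also have "\<dots> \<le> exp (- ?p) ^ M"
    using exp_ge_add_one_self[of "- ?p"] by (intro power_mono) auto
  also have "\<dots> = exp (- (real M * ?p))"
    by (simp flip: exp_of_nat_mult)
  also have "\<dots> \<le> exp (- (real M / 2 ^ (n * N)))"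
  proof -
    have "(2::real) ^ (n * card T) \<le> 2 ^ (n * N)"
      using assms(3) by (intro power_increasing) auto
    thus ?thesis
      by (simp add: prob_uniform_function_agrees[OF assms(1,2)] frac_le)
  qed
  finally show ?thesis .
qed

text \<open>Padding by a repeated element lets all nonempty sets of size at most \<open>N\<close> be
  enumerated by lists of one common length, so that partial functions are easy to count. This is
  where \<open>T \<noteq> {}\<close> in \<open>interpolating\<close> enters.\<close>

lemma exists_list_of_length:
  assumes "finite A" and "A \<noteq> {}" and "card A \<le> N"
  obtains xs where "set xs = A" and "length xs = N"
proof -
  obtain ys where ys: "set ys = A" "distinct ys" using finite_distinct_list[OF assms(1)] by blast
  show thesis
  proof (rule that)
    have "ys \<noteq> []" using ys(1) assms(2) by (metis set_empty)
    hence "hd ys \<in> A" using hd_in_set ys(1) by metis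
    thus "set (ys @ replicate (N - card A) (hd ys)) = A"
      by (simp add: ys(1) set_replicate_conv_if insert_absorb)
    show "length (ys @ replicate (N - card A) (hd ys)) = N"
      using distinct_card[OF ys(2)] assms(3) unfolding ys(1) by simp
  qed
qed

text \<open>Union bound over partial functions, coded as lists of \<open>N\<close> argument-value
  pairs. There are at most \<open>exp (2 * n * N)\<close> of them, each missed with probability at
  most \<open>exp (- (3 * n * N))\<close>.\<close>

lemma prob_not_interpolating:
  assumes "N \<ge> 1" and "M \<ge> 2 ^ (4 * n * N)"
  shows "measure_pmf.prob (random_family n M) {F. \<not> interpolating n N F} \<le> exp (- real n)"
proof -
  define Z where "Z = {zs. set zs \<subseteq> bits n \<times> bits n \<and> length zs = N}"
  \<comment> \<open>Lists that give one point two values are discarded: every family misses them,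
    which would ruin the union bound.\<close>
  define G where "G = {zs \<in> Z. \<exists>g. \<forall>(x, y)\<in>set zs. g x = y}"
  let ?bad = "\<lambda>zs. {F. \<not> (\<exists>f\<in>F. \<forall>(x, y)\<in>set zs. f x = y)}"
  have finZ: "finite Z"
    unfolding Z_def by (rule finite_lists_length_eq) simp
  have "card Z = (2 ^ n * 2 ^ n) ^ N"
    unfolding Z_def by (subst card_lists_length_eq) (simp_all add: card_cartesian_product)
  also have "\<dots> = 2 ^ (2 * n * N)"
    by (simp only: power_add[symmetric] power_mult[symmetric] mult_2)
  finally have cardZ: "card Z = 2 ^ (2 * n * N)" .
  have G: "finite G" "card G \<le> 2 ^ (2 * n * N)"
    using finZ cardZ card_mono[of Z G] by (auto simp: G_def)
  have sub: "{F. \<not> interpolating n N F} \<subseteq> (\<Union>zs\<in>G. ?bad zs)"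
  proof
    fix F assume "F \<in> {F. \<not> interpolating n N F}"
    then obtain T g where T: "T \<subseteq> bits n" "g \<in> T \<rightarrow> bits n" "T \<noteq> {}" "card T \<le> N"
      and none: "\<not> (\<exists>f\<in>F. \<forall>x\<in>T. f x = g x)"
      unfolding interpolating_def by blast
    have "finite T" using T(1) by (rule finite_subset) simp
    then obtain xs where xs: "set xs = T" "length xs = N"
      by (rule exists_list_of_length[OF _ T(3,4)])
    let ?zs = "map (\<lambda>x. (x, g x)) xs"
    have "?zs \<in> G" using T xs by (auto simp: G_def Z_def Pi_iff)
    moreover have "F \<in> ?bad ?zs" using none xs by auto
    ultimately show "F \<in> (\<Union>zs\<in>G. ?bad zs)" by blast
  qed
  have each: "measure_pmf.prob (random_family n M) (?bad zs) \<le> exp (- (real M / 2 ^ (n * N)))"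
    if "zs \<in> G" for zs
  proof -
    from that obtain g where g: "\<forall>(x, y)\<in>set zs. g x = y" and zs: "zs \<in> Z"
      unfolding G_def by blast
    let ?T = "fst ` set zs"
    have "card ?T \<le> N"
      using zs card_image_le[of "set zs" fst] card_length[of zs] by (auto simp: Z_def)
    moreover have "?T \<subseteq> bits n" "g \<in> ?T \<rightarrow> bits n" using zs g by (auto simp: Z_def)
    moreover have "?bad zs = {F. \<not> (\<exists>f\<in>F. \<forall>x\<in>?T. f x = g x)}" using g by fastforce
    ultimately show ?thesis using prob_random_family_misses[of ?T n g N M] by simp
  qed
  \<comment> \<open>Source of the 4 in the bound on \<open>M\<close>: division by
    \<open>2 ^ (n * N)\<close> leaves \<open>2 ^ (3 * n * N)\<close>, and \<open>3 * n * N\<close>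
    exceeds by \<open>n * N\<close> what the union bound costs.\<close>
  have "3 * n * N \<le> 2 ^ (3 * n * N)" by (rule less_imp_le[OF less_exp])
  hence "real (3 * n * N) \<le> 2 ^ (3 * n * N)" by (metis of_nat_le_iff of_nat_numeral of_nat_power)
  also have "(2::real) ^ (3 * n * N) = 2 ^ (4 * n * N) / 2 ^ (n * N)"
    by (subst power_diff[symmetric]) (auto simp: algebra_simps)
  also have "\<dots> \<le> real M / 2 ^ (n * N)"
    using assms(2) by (intro divide_right_mono) (auto dest: of_nat_mono[where ?'a = real])
  finally have M: "real (3 * n * N) \<le> real M / 2 ^ (n * N)" .
  have "n \<le> n * N" using assms(1) by simp
  hence nN: "real n \<le> real (n * N)" by (rule of_nat_mono)
  have "measure_pmf.prob (random_family n M) {F. \<not> interpolating n N F}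
      \<le> measure_pmf.prob (random_family n M) (\<Union>zs\<in>G. ?bad zs)"
    by (rule measure_pmf.finite_measure_mono[OF sub]) simp
  also have "\<dots> \<le> (\<Sum>zs\<in>G. measure_pmf.prob (random_family n M) (?bad zs))"
    using G(1) by (intro measure_pmf.finite_measure_subadditive_finite) auto
  also have "\<dots> \<le> card G * exp (- (real M / 2 ^ (n * N)))"
    using sum_mono[OF each] by simp
  also have "\<dots> \<le> exp (real (2 * n * N)) * exp (- real (3 * n * N))"
  proof (intro mult_mono)
    have "real (card G) \<le> 2 ^ (2 * n * N)" using G(2) by (metis of_nat_le_iff of_nat_numeral of_nat_power)
    also have "\<dots> \<le> exp 1 ^ (2 * n * N)"
      using exp_ge_add_one_self[of 1] by (intro power_mono) auto
    finally show "real (card G) \<le> exp (real (2 * n * N))" by (simp flip: exp_of_nat_mult)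
  qed (use M in auto)
  also have "\<dots> = exp (- real (n * N))"
    unfolding exp_add[symmetric] by (rule arg_cong[where f = exp]) (simp add: algebra_simps)
  also have "\<dots> \<le> exp (- real n)"
    using nN by (simp only: exp_le_cancel_iff neg_le_iff_le)
  finally show ?thesis .
qed

section \<open>A fixed-point-free injection on nonempty messages\<close>

definition flip_hd :: "bool list \<Rightarrow> bool list" where
  "flip_hd s = (\<not> hd s) # tl s"

lemma flip_hd_in_bits: "k \<ge> 1 \<Longrightarrow> s \<in> bits k \<Longrightarrow> flip_hd s \<in> bits k"
  by (simp add: flip_hd_def bits_def)

lemma flip_hd_neq: "flip_hd s \<noteq> s"
  by (cases s) (auto simp: flip_hd_def)

lemma inj_on_flip_hd: "k \<ge> 1 \<Longrightarrow> inj_on flip_hd (bits k)"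
proof (rule inj_onI)
  fix s t assume k: "k \<ge> 1" and s: "s \<in> bits k" and t: "t \<in> bits k" and eq: "flip_hd s = flip_hd t"
  show "s = t"
  proof (rule list.expand)
    have "s \<noteq> []" "t \<noteq> []" using k s t by (auto simp: bits_def)
    thus "(s = []) = (t = [])" by simp
    show "hd s = hd t \<and> tl s = tl t" using eq by (simp add: flip_hd_def)
  qed
qed

section \<open>Total variation distance and supports of coding schemes\<close>

lemma abs_prob_diff_le_tv_dist:
  "\<bar>measure_pmf.prob p A - measure_pmf.prob q A\<bar> \<le> tv_dist p q"
proof -
  let ?d = "\<lambda>A. \<bar>measure_pmf.prob p A - measure_pmf.prob q A\<bar>"
  have "?d A \<le> 1" for A
  proof -
    have "0 \<le> measure_pmf.prob p A" "measure_pmf.prob p A \<le> 1"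
      "0 \<le> measure_pmf.prob q A" "measure_pmf.prob q A \<le> 1" by simp_all
    thus ?thesis by linarith
  qed
  \<comment> \<open>A real supremum dominates its members only if the set is bounded above.\<close>
  hence "bdd_above (range ?d)" by (intro bdd_aboveI2[where M = 1])
  thus ?thesis unfolding tv_dist_def by (rule cSUP_upper[of A UNIV ?d, OF UNIV_I])
qed

lemma coding_scheme_support:
  assumes "coding_scheme n k Enc Dec" and "s \<in> bits k"
  shows "set_pmf (Enc s) \<subseteq> bits n"
proof -
  have "\<forall>s\<in>bits k. set_pmf (Enc s) \<subseteq> bits n"
    using assms(1) unfolding coding_scheme_def by (elim conjE)
  thus ?thesis using assms(2) by (rule bspec)
qed

lemma coding_scheme_decodes:
  assumes "coding_scheme n k Enc Dec" and "s \<in> bits k" and "c \<in> set_pmf (Enc s)"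
  shows "Dec c = Some s"
proof -
  have "\<forall>s\<in>bits k. measure_pmf.prob (Enc s) {c. Dec c = Some s} = 1"
    using assms(1) unfolding coding_scheme_def by (elim conjE)
  hence "measure_pmf.prob (Enc s) {c. Dec c = Some s} = 1" using assms(2) by (rule bspec)
  thus ?thesis using assms(3) by (auto simp: measure_pmf.prob_eq_1 AE_measure_pmf_iff)
qed

text \<open>Correct decoding makes the supports of different messages disjoint. With fewer than
  \<open>m\<close> small supports, at least half of the messages would have more than
  \<open>L\<close> codewords each, and these do not fit into \<open>bits n\<close>.\<close>

lemma coding_scheme_small_supports:
  assumes cs: "coding_scheme n k Enc Dec" and "2 * m \<le> 2 ^ k" and "2 * 2 ^ n \<le> L * 2 ^ k"
  shows "\<exists>S\<subseteq>bits k. card S = m \<and> (\<forall>s\<in>S. card (set_pmf (Enc s)) \<le> L)"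
proof -
  let ?A = "{s \<in> bits k. card (set_pmf (Enc s)) \<le> L}"
  have sup: "set_pmf (Enc s) \<subseteq> bits n" if "s \<in> bits k" for s
    using coding_scheme_support[OF cs that] .
  have "m \<le> card ?A"
  proof (rule ccontr)
    assume "\<not> m \<le> card ?A"
    define B where "B = bits k - ?A"
    have B: "s \<in> bits k" "L < card (set_pmf (Enc s))" if "s \<in> B" for s
      using that by (auto simp: B_def)
    have finB: "finite B" by (simp add: B_def)
    have "card B = 2 ^ k - card ?A" unfolding B_def by (subst card_Diff_subset) auto
    hence half: "2 ^ k \<le> 2 * card B" using assms(2) \<open>\<not> m \<le> card ?A\<close> by linarith
    \<comment> \<open>Nonemptiness makes the sum comparison below strict, as the contradiction with
      the non-strict \<open>2 * 2 ^ n \<le> L * 2 ^ k\<close> requires.\<close>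
    hence "B \<noteq> {}" by auto
    have "card B * L = (\<Sum>s\<in>B. L)" by simp
    also have "\<dots> < (\<Sum>s\<in>B. card (set_pmf (Enc s)))"
      by (rule sum_strict_mono[OF finB \<open>B \<noteq> {}\<close> B(2)])
    also have "\<dots> = card (\<Union>s\<in>B. set_pmf (Enc s))"
    proof (rule card_UN_disjoint[OF finB, symmetric])
      show "\<forall>s\<in>B. finite (set_pmf (Enc s))"
        using finite_subset[OF sup[OF B(1)] finite_bits] by blast
      show "\<forall>s\<in>B. \<forall>t\<in>B. s \<noteq> t \<longrightarrow> set_pmf (Enc s) \<inter> set_pmf (Enc t) = {}"
      proof (intro ballI impI equals0I)
        fix s t c assume "s \<in> B" "t \<in> B" "s \<noteq> t" "c \<in> set_pmf (Enc s) \<inter> set_pmf (Enc t)"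
        thus False
          using coding_scheme_decodes[OF cs B(1), of s c] coding_scheme_decodes[OF cs B(1), of t c]
          by simp
      qed
    qed
    also have "\<dots> \<le> card (bits n)" using sup[OF B(1)] by (intro card_mono finite_bits UN_least)
    finally have "card B * L < 2 ^ n" by simp
    moreover have "2 ^ k * L \<le> 2 * card B * L" using half by (rule mult_right_mono) simp
    moreover have "2 * card B * L = 2 * (card B * L)" "2 ^ k * L = L * 2 ^ k" by simp_all
    ultimately show False using assms(3) by linarith
  qed
  then obtain S where "S \<subseteq> ?A" "card S = m" "finite S" by (rule obtain_subset_with_card_n)
  thus ?thesis by (intro exI[of _ S]) auto
qed

text \<open>The tampering function sends every codeword of \<open>s\<close> to a codeword of \<^term>\<open>flip_hd s\<close>,
  for \<open>m\<close> messages \<open>s\<close>. A simulator with error \<open>\<epsilon>\<close> would need mass \<open>1 - \<epsilon>\<close> on each of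
  the \<open>m\<close> distinct outputs \<^term>\<open>flip_hd s\<close>, which none of them can obtain through \<^const>\<open>Same\<close>.\<close>

lemma interpolating_not_non_malleable:
  assumes cs: "coding_scheme n k Enc Dec" and int: "interpolating n (m * L) F"
    and "k \<ge> 1" and "m \<ge> 1" and "2 * m \<le> 2 ^ k" and "2 * 2 ^ n \<le> L * 2 ^ k"
    and eps: "real m * (1 - \<epsilon>) > 1"
  shows "\<not> non_malleable k Enc Dec \<epsilon> F"
proof
  assume nm: "non_malleable k Enc Dec \<epsilon> F"
  obtain S where S: "S \<subseteq> bits k" "card S = m" "\<And>s. s \<in> S \<Longrightarrow> card (set_pmf (Enc s)) \<le> L"
    using coding_scheme_small_supports[OF cs assms(5,6)] by blast
  have finS: "finite S" using S(1) by (rule finite_subset) simp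
  have sup: "set_pmf (Enc s) \<subseteq> bits n" if "s \<in> bits k" for s
    using coding_scheme_support[OF cs that] .
  define T where "T = (\<Union>s\<in>S. set_pmf (Enc s))"
  \<comment> \<open>Decoding recovers the message from its codeword, so a single \<open>g\<close>
    serves all of \<open>S\<close>. The flipped message may lie outside \<open>S\<close> and have
    many codewords: only the size of the domain \<open>T\<close> matters.\<close>
  define g where "g x = (SOME c. c \<in> set_pmf (Enc (flip_hd (the (Dec x)))))" for x
  have g: "g x \<in> set_pmf (Enc (flip_hd s))" if "s \<in> S" "x \<in> set_pmf (Enc s)" for s x
  proof -
    have "Dec x = Some s" using that S(1) coding_scheme_decodes[OF cs] by auto
    thus ?thesis by (simp add: g_def some_in_eq set_pmf_not_empty)
  qed
  have "card T \<le> (\<Sum>s\<in>S. card (set_pmf (Enc s)))" unfolding T_def by (rule card_UN_le[OF finS])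
  also have "\<dots> \<le> m * L" using sum_bounded_above[of S _ L] S by auto
  finally have "card T \<le> m * L" .
  moreover have "T \<subseteq> bits n" using S(1) sup by (auto simp: T_def)
  moreover have "g \<in> T \<rightarrow> bits n"
  proof
    fix x assume "x \<in> T"
    then obtain s where s: "s \<in> S" "x \<in> set_pmf (Enc s)" by (auto simp: T_def)
    hence "flip_hd s \<in> bits k" using S(1) flip_hd_in_bits[OF assms(3)] by blast
    thus "g x \<in> bits n" using g[OF s] sup by blast
  qed
  moreover have "T \<noteq> {}"
    using S(2) assms(4) by (auto simp: T_def set_pmf_not_empty)
  ultimately obtain f where f: "f \<in> F" "\<forall>x\<in>T. f x = g x"
    using int unfolding interpolating_def by blast
  obtain D :: "sim_output pmf" where
    D: "tv_dist (map_pmf (\<lambda>c. Dec (f c)) (Enc s)) (map_pmf (\<lambda>x. copy x s) D) \<le> \<epsilon>"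
    if "s \<in> bits k" for s
    using nm f(1) unfolding non_malleable_def by blast
  let ?O = "\<lambda>s. Output (Some (flip_hd s))"
  have mass: "1 - \<epsilon> \<le> pmf D (?O s)" if s: "s \<in> S" for s
  proof -
    let ?A = "{Some (flip_hd s)}"
    have "Dec (f c) = Some (flip_hd s)" if "c \<in> set_pmf (Enc s)" for c
    proof (rule coding_scheme_decodes[OF cs])
      show "flip_hd s \<in> bits k" using s S(1) flip_hd_in_bits[OF assms(3)] by blast
      have "f c = g c" using f(2) s that by (auto simp: T_def)
      thus "f c \<in> set_pmf (Enc (flip_hd s))" using g[OF s that] by simp
    qed
    hence "measure_pmf.prob (Enc s) ((\<lambda>c. Dec (f c)) -` ?A) = 1"
      by (simp add: measure_pmf.prob_eq_1 AE_measure_pmf_iff)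
    moreover have "(\<lambda>x. copy x s) -` ?A = {?O s}"
    proof (rule set_eqI)
      fix x show "x \<in> (\<lambda>x. copy x s) -` ?A \<longleftrightarrow> x \<in> {?O s}"
        using flip_hd_neq[of s] by (cases x) auto
    qed
    ultimately have "1 - pmf D (?O s)
        \<le> tv_dist (map_pmf (\<lambda>c. Dec (f c)) (Enc s)) (map_pmf (\<lambda>x. copy x s) D)"
      using abs_prob_diff_le_tv_dist[of "map_pmf (\<lambda>c. Dec (f c)) (Enc s)" ?A "map_pmf (\<lambda>x. copy x s) D"]
      unfolding measure_map_pmf by (simp add: measure_pmf_single)
    thus ?thesis using D[of s] s S(1) by fastforce
  qed
  have "inj_on ?O S"
    using inj_on_subset[OF inj_on_flip_hd[OF assms(3)] S(1)] by (auto simp: inj_on_def)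
  hence "(\<Sum>s\<in>S. pmf D (?O s)) = measure_pmf.prob D (?O ` S)"
    using finS by (simp add: measure_measure_pmf_finite sum.reindex)
  also have "\<dots> \<le> 1" by simp
  finally have "(\<Sum>s\<in>S. pmf D (?O s)) \<le> 1" .
  moreover have "real m * (1 - \<epsilon>) \<le> (\<Sum>s\<in>S. pmf D (?O s))"
    unfolding S(2)[symmetric] by (rule sum_bounded_below[OF mass])
  ultimately show False using eps by linarith
qed

section \<open>Choice of parameters and conclusion\<close>

theorem theorem5p1:
  fixes \<alpha> :: real
  assumes "0 < \<alpha>" and "\<alpha> < 1"
  shows "\<exists>M\<^sub>0 :: nat \<Rightarrow> nat.
    (\<exists>g \<in> O(\<lambda>n. log 2 (real n)). \<forall>n. log 2 (log 2 (real (M\<^sub>0 n))) \<le> \<alpha> * real n + g n) \<and>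
    (\<forall>\<epsilon> < (1::real). \<forall>\<^sub>F n in sequentially. \<forall>M \<ge> M\<^sub>0 n.
       measure_pmf.prob (random_family n M)
         {F. \<not> (\<exists>k Enc Dec. coding_scheme n k Enc Dec \<and> rate n k \<ge> 1 - \<alpha> \<and>
                              non_malleable k Enc Dec \<epsilon> F)}
       \<ge> 1 - exp (- real n))"
proof -
  \<comment> \<open>The rate gives \<open>2 ^ k \<ge> 2 powr ((1 - \<alpha>) * n)\<close>, so this
    \<open>L n\<close> ensures \<open>2 * 2 ^ n \<le> L n * 2 ^ k\<close>. The exponent in the next
    line is \<open>4 * n * N\<close> for \<open>N = n * L n\<close>: \<open>n\<close> messages with
    at most \<open>L n\<close> codewords each.\<close>
  define L where "L n = nat \<lceil>2 * 2 powr (\<alpha> * real n)\<rceil>" for n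
  define M\<^sub>0 :: "nat \<Rightarrow> nat" where "M\<^sub>0 n = 2 ^ (4 * n * (n * L n))" for n
  have L_ge: "2 * 2 powr (\<alpha> * real n) \<le> real (L n)" for n
    unfolding L_def by linarith
  have pow_ge: "1 \<le> 2 powr (\<alpha> * real n)" for n
    using assms(1) by (simp add: ge_one_powr_ge_zero)
  \<comment> \<open>Rounding up adds at most 1, which \<open>2 powr (\<alpha> * n)\<close> absorbs.
    The 3 times the 4 of the exponent yields the 12 below.\<close>
  have L_le: "real (L n) \<le> 3 * 2 powr (\<alpha> * real n)" for n
    unfolding L_def using pow_ge[of n] by linarith
  have L_pos: "1 \<le> L n" for n
    using L_ge[of n] pow_ge[of n] by linarith
  have loglog: "log 2 (log 2 (real (M\<^sub>0 n))) \<le> \<alpha> * real n + (log 2 12 + 2 * log 2 (real n))" for n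
  proof (cases "n = 0")
    \<comment> \<open>Here \<open>log 2 0 = 0\<close> by convention, so the left side is 0 and the
      right side is \<open>log 2 12\<close>.\<close>
    case True
    thus ?thesis by (simp add: M\<^sub>0_def log_def)
  next
    case False
    have "log 2 (log 2 (real (M\<^sub>0 n))) = log 2 (4 * real n ^ 2 * real (L n))"
      by (simp add: M\<^sub>0_def log_nat_power power2_eq_square mult_ac)
    also have "\<dots> \<le> log 2 (4 * real n ^ 2 * (3 * 2 powr (\<alpha> * real n)))"
      using False L_le[of n] L_pos[of n] by (subst log_le_cancel_iff) auto
    also have "\<dots> = log 2 (12 * real n ^ 2 * 2 powr (\<alpha> * real n))"
      by (rule arg_cong[where f = "log 2"]) simp
    also have "\<dots> = \<alpha> * real n + (log 2 12 + 2 * log 2 (real n))"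
      using False by (simp add: log_mult log_nat_power)
    finally show ?thesis .
  qed
  have O: "(\<lambda>n. log 2 12 + 2 * log 2 (real n)) \<in> O(\<lambda>n. log 2 (real n))"
    unfolding log_def by real_asymp
  have main: "\<forall>\<^sub>F n in sequentially. \<forall>M \<ge> M\<^sub>0 n.
       measure_pmf.prob (random_family n M)
         {F. \<not> (\<exists>k Enc Dec. coding_scheme n k Enc Dec \<and> rate n k \<ge> 1 - \<alpha> \<and>
                              non_malleable k Enc Dec \<epsilon> F)}
       \<ge> 1 - exp (- real n)" if "\<epsilon> < 1" for \<epsilon> :: real
  proof -
    \<comment> \<open>The first bound lets \<open>n\<close> messages fit into half of all messages;
      the second makes \<open>n\<close> masses of \<open>1 - \<epsilon>\<close> exceed 1. Only the
      threshold on \<open>n\<close> depends on \<epsilon>, not \<open>M\<^sub>0\<close>.\<close>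
    have "\<forall>\<^sub>F n in sequentially. 2 * real n \<le> 2 powr ((1 - \<alpha>) * real n)"
      using assms(2) by real_asymp
    moreover have "\<forall>\<^sub>F n in sequentially. real n * (1 - \<epsilon>) > 1"
      using that by real_asymp
    ultimately show ?thesis using eventually_ge_at_top[of 1]
    proof eventually_elim
      case (elim n)
      have "\<not> non_malleable k Enc Dec \<epsilon> F"
        if int: "interpolating n (n * L n) F" and cs: "coding_scheme n k Enc Dec"
          and rate: "rate n k \<ge> 1 - \<alpha>" for F k Enc Dec
      proof -
        have k: "(1 - \<alpha>) * real n \<le> real k"
          using rate elim(3) by (simp add: rate_def field_simps)
        have "k \<ge> 1"
          using k elim(3) assms(2) by (cases k) (auto simp: mult_le_0_iff)
        have "2 powr ((1 - \<alpha>) * real n) \<le> 2 ^ k"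
          using k by (simp flip: powr_realpow)
        hence "real (2 * n) \<le> real (2 ^ k)" using elim(1) by simp
        hence "2 * n \<le> 2 ^ k" by (simp only: of_nat_le_iff)
        have "2 * 2 ^ n = 2 * 2 powr (\<alpha> * real n) * 2 powr ((1 - \<alpha>) * real n)"
          by (simp add: algebra_simps flip: powr_realpow powr_add)
        also have "\<dots> \<le> real (L n) * 2 ^ k"
          using L_ge[of n] \<open>2 powr ((1 - \<alpha>) * real n) \<le> 2 ^ k\<close> by (intro mult_mono) auto
        finally have "real (2 * 2 ^ n) \<le> real (L n * 2 ^ k)" by simp
        hence "2 * 2 ^ n \<le> L n * 2 ^ k" by (simp only: of_nat_le_iff)
        show ?thesis
          by (rule interpolating_not_non_malleable) fact+
      qed
      \<comment> \<open>Interpolation concerns the family alone, so one event rules out all coding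
        schemes at once, without a union bound over schemes.\<close>
      hence sub: "{F. interpolating n (n * L n) F} \<subseteq> {F. \<not> (\<exists>k Enc Dec. coding_scheme n k Enc Dec \<and>
                 rate n k \<ge> 1 - \<alpha> \<and> non_malleable k Enc Dec \<epsilon> F)}"
        by blast
      show ?case
      proof (intro allI impI)
        fix M assume "M \<ge> M\<^sub>0 n"
        let ?P = "measure_pmf.prob (random_family n M)"
        have "1 - exp (- real n) \<le> 1 - ?P {F. \<not> interpolating n (n * L n) F}"
          using prob_not_interpolating[of "n * L n" n M] \<open>M \<ge> M\<^sub>0 n\<close> elim(3) L_pos[of n]
          by (simp add: M\<^sub>0_def)
        also have "\<dots> = ?P {F. interpolating n (n * L n) F}"
          using measure_pmf.prob_compl[of "{F. interpolating n (n * L n) F}" "random_family n M"]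
          by (simp add: set_diff_eq)
        also have "\<dots> \<le> ?P {F. \<not> (\<exists>k Enc Dec. coding_scheme n k Enc Dec \<and>
                 rate n k \<ge> 1 - \<alpha> \<and> non_malleable k Enc Dec \<epsilon> F)}"
          by (rule measure_pmf.finite_measure_mono[OF sub]) simp
        finally show "?P {F. \<not> (\<exists>k Enc Dec. coding_scheme n k Enc Dec \<and>
                 rate n k \<ge> 1 - \<alpha> \<and> non_malleable k Enc Dec \<epsilon> F)} \<ge> 1 - exp (- real n)" .
      qed
    qed
  qed
  show ?thesis
    by (intro exI[of _ M\<^sub>0] conjI bexI[OF _ O] allI impI loglog main)
qed

end
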